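(* Let $r \geq 3$ and $n \geq 0$ be integers. There exists a twin-free $K_r$-saturated graph on $n$ vertices if and only if none of the following holds: $n=r$; $n=r+1$; $r=3$ and $n=6$; $r=3$ and $n=7$.
   Context: All graphs are finite and simple. For a vertex $v$, $\Gamma(v)$ denotes its (open) neighbourhood. Two distinct vertices $v,w$ are twins if $\Gamma(v)=\Gamma(w)$; a graph is twin-free if it has no pair of twins. A graph $G$ is $K_r$-saturated if $G$ contains no copy of $K_r$ but adding any edge between two non-adjacent vertices of $G$ creates a copy of $K_r$. *)

theory Defs
  imports Main
begin

definition simple_graph :: "'a set \<Rightarrow> 'a set set \<Rightarrow> bool" where
  "simple_graph V E \<longleftrightarrow> finite V \<and> (\<forall>e\<in>E. e \<subseteq> V \<and> card e = 2)"

definition neighbourhood :: "'a set \<Rightarrow> 'a set set \<Rightarrow> 'a \<Rightarrow> 'a set" where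
  "neighbourhood V E v = {w \<in> V. {v, w} \<in> E}"

definition twins :: "'a set \<Rightarrow> 'a set set \<Rightarrow> 'a \<Rightarrow> 'a \<Rightarrow> bool" where
  "twins V E v w \<longleftrightarrow> v \<in> V \<and> w \<in> V \<and> v \<noteq> w \<and> neighbourhood V E v = neighbourhood V E w"

definition twin_free :: "'a set \<Rightarrow> 'a set set \<Rightarrow> bool" where
  "twin_free V E \<longleftrightarrow> \<not> (\<exists>v w. twins V E v w)"

definition contains_complete :: "nat \<Rightarrow> 'a set \<Rightarrow> 'a set set \<Rightarrow> bool" where
  "contains_complete r V E \<longleftrightarrow>
     (\<exists>S. S \<subseteq> V \<and> finite S \<and> card S = r \<and> (\<forall>v\<in>S. \<forall>w\<in>S. v \<noteq> w \<longrightarrow> {v, w} \<in> E))"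

definition complete_saturated :: "nat \<Rightarrow> 'a set \<Rightarrow> 'a set set \<Rightarrow> bool" where
  "complete_saturated r V E \<longleftrightarrow>
     \<not> contains_complete r V E \<and>
     (\<forall>v\<in>V. \<forall>w\<in>V. v \<noteq> w \<and> {v, w} \<notin> E \<longrightarrow> contains_complete r V (insert {v, w} E))"

end

theory Submission imports Defs begin

text \<open>
  In a \<open>K\<^sub>r\<close>-saturated graph on \<open>r\<close> vertices the ends of a non-edge are adjacent to all other
  vertices, so they are twins. On \<open>r + 1\<close> vertices, let \<open>x\<close> be adjacent to \<open>u\<close> but not to \<open>w\<close>, where
  \<open>u\<close> and \<open>w\<close> are not adjacent; saturation at \<open>uw\<close> and at \<open>wx\<close> makes the vertices other than \<open>w\<close> a
  \<open>K\<^sub>r\<close>. For \<open>r = 3\<close> neighbourhoods are maximal independent sets, so two comparable ones are equal.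
  A twin-free graph of this kind on at least three vertices contains a pentagon. If just one or
  two vertices lie off the pentagon, each of them has the same neighbours on it as one of its
  vertices; their neighbourhoods differ in at most one vertex, so they are comparable and thus
  equal.

  Conversely, joining a new vertex to the whole graph turns a solution for \<open>(r, n)\<close> into one for
  \<open>(r + 1, n + 1)\<close>, and joining it to a maximal \<open>K\<^bsub>r-1\<^esub>\<close>-free set that is not a neighbourhood yields
  one for \<open>(r, n + 1)\<close>. For \<open>r = 3\<close> the second operation can be iterated forever from a suitable
  graph on nine vertices. The pentagon, the Moebius ladder on eight vertices and the complement of the
  7-cycle provide the remaining starting points.
\<close>

section \<open>Graphs given by neighbourhoods\<close>

locale neighbourhood_graph =
  fixes V :: "'a set" and N :: "'a \<Rightarrow> 'a set"
  assumes finite_vertices: "finite V"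
    and nbhd_subset: "v \<in> V \<Longrightarrow> N v \<subseteq> V"
    and nbhd_irrefl: "v \<in> V \<Longrightarrow> v \<notin> N v"
    and nbhd_sym: "v \<in> V \<Longrightarrow> w \<in> N v \<Longrightarrow> v \<in> N w"

abbreviation clique :: "('a \<Rightarrow> 'a set) \<Rightarrow> 'a set \<Rightarrow> bool" where
  "clique N K \<equiv> pairwise (\<lambda>u v. v \<in> N u) K"

definition has_clique :: "('a \<Rightarrow> 'a set) \<Rightarrow> nat \<Rightarrow> 'a set \<Rightarrow> bool" where
  "has_clique N k S \<longleftrightarrow> (\<exists>K\<subseteq>S. finite K \<and> card K = k \<and> clique N K)"

lemma has_clique_mono: "has_clique N k S \<Longrightarrow> S \<subseteq> T \<Longrightarrow> has_clique N k T"
  unfolding has_clique_def by blast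

lemma has_clique_cong:
  assumes "\<And>u v. u \<in> S \<Longrightarrow> v \<in> S \<Longrightarrow> v \<in> N u \<longleftrightarrow> v \<in> N' u"
  shows "has_clique N k S \<longleftrightarrow> has_clique N' k S"
proof -
  have "clique N K \<longleftrightarrow> clique N' K" if "K \<subseteq> S" for K
    using assms that unfolding pairwise_def by blast
  then show ?thesis unfolding has_clique_def by blast
qed

lemma has_clique_0: "has_clique N 0 S"
  unfolding has_clique_def by (intro exI[of _ "{}"]) simp

lemma has_clique_nbhd:
  assumes "K \<subseteq> S" "finite K" "card K = Suc k" "clique N K" "v \<in> K"
  shows "has_clique N k (S \<inter> N v)"
proof -
  have "K - {v} \<subseteq> S \<inter> N v" "clique N (K - {v})"
    using assms(1,5) pairwiseD[OF assms(4)] pairwise_subset[OF assms(4)] by auto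
  moreover have "finite (K - {v})" "card (K - {v}) = k" using assms(2,3,5) by auto
  ultimately show ?thesis unfolding has_clique_def by blast
qed

context neighbourhood_graph
begin

lemma clique_insert:
  assumes "v \<in> V" "K \<subseteq> N v" "clique N K"
  shows "clique N (insert v K)"
  unfolding pairwise_insert using assms nbhd_sym[OF assms(1)] by auto

lemma has_clique_SucI:
  assumes "has_clique N k (S \<inter> N v)" "v \<in> S" "v \<in> V"
  shows "has_clique N (Suc k) S"
proof -
  obtain K where K: "K \<subseteq> S \<inter> N v" "finite K" "card K = k" "clique N K"
    using assms(1) unfolding has_clique_def by blast
  have "v \<notin> K" using K(1) nbhd_irrefl[OF assms(3)] by blast
  then have "card (insert v K) = Suc k" using K(2,3) by simp
  moreover have "clique N (insert v K)"
    using K(1,4) assms(3) by (intro clique_insert) auto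
  ultimately show ?thesis
    using K(1,2) assms(2) unfolding has_clique_def by (intro exI[of _ "insert v K"]) auto
qed

lemma has_clique_Suc:
  assumes "S \<subseteq> V"
  shows "has_clique N (Suc k) S \<longleftrightarrow> (\<exists>v\<in>S. has_clique N k (S \<inter> N v))"
proof
  assume "has_clique N (Suc k) S"
  then obtain K where K: "K \<subseteq> S" "finite K" "card K = Suc k" "clique N K"
    unfolding has_clique_def by blast
  then have "K \<noteq> {}" by auto
  then obtain v where v: "v \<in> K" by blast
  have "has_clique N k (S \<inter> N v)" using has_clique_nbhd[OF K v] .
  then show "\<exists>v\<in>S. has_clique N k (S \<inter> N v)" using v K(1) by blast
next
  assume "\<exists>v\<in>S. has_clique N k (S \<inter> N v)"
  then obtain v where "v \<in> S" "has_clique N k (S \<inter> N v)" by blast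
  then show "has_clique N (Suc k) S" using has_clique_SucI assms by (simp add: subset_iff)
qed

lemma has_clique_insert:
  assumes "insert x S \<subseteq> V"
  shows "has_clique N (Suc k) (insert x S) \<longleftrightarrow> has_clique N (Suc k) S \<or> has_clique N k (S \<inter> N x)"
proof -
  have nbhd: "insert x S \<inter> N x = S \<inter> N x" using nbhd_irrefl assms by simp
  have "has_clique N (Suc k) S \<or> has_clique N k (S \<inter> N x)"
    if inserted: "has_clique N (Suc k) (insert x S)"
  proof -
    obtain K where K: "K \<subseteq> insert x S" "finite K" "card K = Suc k" "clique N K"
      using inserted unfolding has_clique_def by blast
    show ?thesis
    proof (cases "x \<in> K")
      case True
      then show ?thesis using has_clique_nbhd[OF K True] nbhd by simp
    next
      case False
      then have "K \<subseteq> S" using K(1) by blast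
      then show ?thesis using K(2-4) unfolding has_clique_def by blast
    qed
  qed
  moreover have "has_clique N (Suc k) (insert x S)" if "has_clique N (Suc k) S"
    using that by (rule has_clique_mono) blast
  moreover have "has_clique N (Suc k) (insert x S)" if "has_clique N k (S \<inter> N x)"
    using that has_clique_SucI[of k "insert x S" x] nbhd assms by simp
  ultimately show ?thesis by blast
qed

lemma has_clique_1:
  assumes "S \<subseteq> V"
  shows "has_clique N 1 S \<longleftrightarrow> S \<noteq> {}"
  using has_clique_Suc[OF assms, of 0] by (auto simp: has_clique_0)

lemma has_clique_2:
  assumes "S \<subseteq> V"
  shows "has_clique N 2 S \<longleftrightarrow> (\<exists>v\<in>S. S \<inter> N v \<noteq> {})"
proof -
  have "has_clique N 1 (S \<inter> N v) \<longleftrightarrow> S \<inter> N v \<noteq> {}" for v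
    using assms by (intro has_clique_1) blast
  then show ?thesis using has_clique_Suc[OF assms, of 1] by (simp add: numeral_2_eq_2)
qed

lemma has_clique_3:
  assumes "S \<subseteq> V"
  shows "has_clique N 3 S \<longleftrightarrow> (\<exists>u\<in>S. \<exists>v\<in>S \<inter> N u. S \<inter> N u \<inter> N v \<noteq> {})"
proof -
  have "has_clique N 2 (S \<inter> N u) \<longleftrightarrow> (\<exists>v\<in>S \<inter> N u. S \<inter> N u \<inter> N v \<noteq> {})" for u
    using assms by (intro has_clique_2) blast
  then show ?thesis using has_clique_Suc[OF assms, of 2] by simp
qed

end

locale saturated_graph = neighbourhood_graph V N for V :: "'a set" and N +
  fixes r :: nat
  assumes two_le: "2 \<le> r"
    and clique_free: "\<not> has_clique N r V"
    and completes_clique: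
      "v \<in> V \<Longrightarrow> w \<in> V \<Longrightarrow> v \<noteq> w \<Longrightarrow> w \<notin> N v \<Longrightarrow> has_clique N (r - 2) (N v \<inter> N w)"

lemma neighbourhood_graph_iff:
  "neighbourhood_graph V N \<longleftrightarrow>
    finite V \<and> (\<forall>v\<in>V. N v \<subseteq> V \<and> v \<notin> N v \<and> (\<forall>w\<in>N v. v \<in> N w))"
  unfolding neighbourhood_graph_def by blast

lemma saturated_graph_iff:
  "saturated_graph V N r \<longleftrightarrow> neighbourhood_graph V N \<and> 2 \<le> r \<and> \<not> has_clique N r V \<and>
    (\<forall>v\<in>V. \<forall>w\<in>V. v = w \<or> w \<in> N v \<or> has_clique N (r - 2) (N v \<inter> N w))"
  unfolding saturated_graph_def saturated_graph_axioms_def by blast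

lemma saturated_graph_3_iff:
  "saturated_graph V N 3 \<longleftrightarrow> neighbourhood_graph V N \<and>
    (\<forall>v\<in>V. \<forall>w\<in>N v. N v \<inter> N w = {}) \<and>
    (\<forall>v\<in>V. \<forall>w\<in>V. v = w \<or> w \<in> N v \<or> N v \<inter> N w \<noteq> {})"
proof (cases "neighbourhood_graph V N")
  case True
  then interpret neighbourhood_graph V N .
  have "has_clique N 3 V \<longleftrightarrow> (\<exists>v\<in>V. \<exists>w\<in>N v. N v \<inter> N w \<noteq> {})"
    using has_clique_3[of V] nbhd_subset by blast
  moreover have "has_clique N 1 (N v \<inter> N w) \<longleftrightarrow> N v \<inter> N w \<noteq> {}" if "v \<in> V" for v w
    using that nbhd_subset by (intro has_clique_1) blast
  ultimately show ?thesis using True unfolding saturated_graph_iff by simp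
qed (simp add: saturated_graph_iff)

lemma saturated_graph_4_iff:
  "saturated_graph V N 4 \<longleftrightarrow> neighbourhood_graph V N \<and>
    (\<forall>u\<in>V. \<forall>v\<in>N u. \<forall>w\<in>N u \<inter> N v. N u \<inter> N v \<inter> N w = {}) \<and>
    (\<forall>v\<in>V. \<forall>w\<in>V. v = w \<or> w \<in> N v \<or> (\<exists>x\<in>N v \<inter> N w. N v \<inter> N w \<inter> N x \<noteq> {}))"
proof (cases "neighbourhood_graph V N")
  case True
  then interpret neighbourhood_graph V N .
  have "has_clique N 3 (V \<inter> N u) \<longleftrightarrow> (\<exists>v\<in>N u. \<exists>w\<in>N u \<inter> N v. N u \<inter> N v \<inter> N w \<noteq> {})"
    if "u \<in> V" for u
    using has_clique_3[OF nbhd_subset] nbhd_subset that by (simp add: inf.absorb2)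
  then have "has_clique N 4 V \<longleftrightarrow>
      (\<exists>u\<in>V. \<exists>v\<in>N u. \<exists>w\<in>N u \<inter> N v. N u \<inter> N v \<inter> N w \<noteq> {})"
    using has_clique_Suc[of V 3] by simp
  moreover have "has_clique N 2 (N v \<inter> N w) \<longleftrightarrow> (\<exists>x\<in>N v \<inter> N w. N v \<inter> N w \<inter> N x \<noteq> {})"
    if "v \<in> V" for v w
    using that nbhd_subset by (intro has_clique_2) blast
  ultimately show ?thesis using True unfolding saturated_graph_iff by simp
qed (simp add: saturated_graph_iff)

lemma saturated_graph_cong:
  assumes "saturated_graph V N r" and eq: "\<And>v. v \<in> V \<Longrightarrow> N' v = N v"
  shows "saturated_graph V N' r"
proof -
  interpret saturated_graph V N r by fact
  have cliques: "has_clique N' k S \<longleftrightarrow> has_clique N k S" if "S \<subseteq> V" for k S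
    using that eq by (intro has_clique_cong) blast
  show ?thesis
  proof
    show "\<not> has_clique N' r V" using clique_free cliques by simp
  next
    fix v assume v: "v \<in> V"
    show "N' v \<subseteq> V" "v \<notin> N' v" using v nbhd_subset nbhd_irrefl eq by simp_all
    show "v \<in> N' w" if "w \<in> N' v" for w
      using that v nbhd_sym[of v w] nbhd_subset[of v] eq by auto
    show "has_clique N' (r - 2) (N' v \<inter> N' w)" if w: "w \<in> V" "v \<noteq> w" "w \<notin> N' v" for w
    proof -
      have "N v \<inter> N w \<subseteq> V" using nbhd_subset v by blast
      then show ?thesis using completes_clique cliques v w eq by simp
    qed
  qed (fact finite_vertices two_le)+
qed

lemma neighbourhood_graph_neighbourhood:
  assumes "simple_graph V E"
  shows "neighbourhood_graph V (neighbourhood V E)"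
proof
  fix v w
  show "finite V" using assms by (simp add: simple_graph_def)
  show "neighbourhood V E v \<subseteq> V" by (auto simp: neighbourhood_def)
  have "card {v, v} = 2" if "{v, v} \<in> E" using assms that unfolding simple_graph_def by blast
  then show "v \<notin> neighbourhood V E v" by (auto simp: neighbourhood_def)
  show "v \<in> neighbourhood V E w" if "w \<in> neighbourhood V E v" "v \<in> V"
    using that by (simp add: neighbourhood_def insert_commute)
qed

lemma contains_complete_iff_has_clique:
  "finite V \<Longrightarrow> contains_complete r V E \<longleftrightarrow> has_clique (neighbourhood V E) r V"
  unfolding contains_complete_def has_clique_def pairwise_def neighbourhood_def
  by (intro ex_cong1) blast

lemma contains_complete_insert_edge_iff:
  assumes simple: "simple_graph V E" and free: "\<not> contains_complete (Suc (Suc k)) V E"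
    and vw: "v \<in> V" "w \<in> V" "v \<noteq> w"
  shows "contains_complete (Suc (Suc k)) V (insert {v, w} E) \<longleftrightarrow>
    has_clique (neighbourhood V E) k (neighbourhood V E v \<inter> neighbourhood V E w)"
proof -
  let ?N = "neighbourhood V E" and ?N' = "neighbourhood V (insert {v, w} E)"
  let ?U = "V - {v, w}"
  interpret neighbourhood_graph V ?N by (rule neighbourhood_graph_neighbourhood) fact
  have "simple_graph V (insert {v, w} E)" using simple vw by (simp add: simple_graph_def)
  then interpret extended: neighbourhood_graph V ?N' by (rule neighbourhood_graph_neighbourhood)
  have cliques: "has_clique ?N' j S \<longleftrightarrow> has_clique ?N j S" if "\<not> {v, w} \<subseteq> S" for j S
    using that by (intro has_clique_cong) (auto simp: neighbourhood_def doubleton_eq_iff)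
  have no_clique: "\<not> has_clique ?N (Suc (Suc k)) V"
    using free finite_vertices by (simp add: contains_complete_iff_has_clique)
  have "\<not> has_clique ?N (Suc (Suc k)) (insert w ?U)"
    using no_clique vw has_clique_mono[of ?N _ "insert w ?U" V] by blast
  moreover have "\<not> has_clique ?N (Suc k) (?U \<inter> ?N v)"
    using no_clique vw(1) has_clique_SucI[of "Suc k" V v]
      has_clique_mono[of ?N "Suc k" "?U \<inter> ?N v" "V \<inter> ?N v"] by blast
  moreover have "V = insert v (insert w ?U)" "insert w ?U \<inter> ?N' v = insert w (?U \<inter> ?N v)"
      "?U \<inter> ?N v \<inter> ?N' w = ?N v \<inter> ?N w"
    using vw nbhd_irrefl by (auto simp: neighbourhood_def doubleton_eq_iff)
  ultimately have "has_clique ?N' (Suc (Suc k)) V \<longleftrightarrow> has_clique ?N k (?N v \<inter> ?N w)"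
    using vw nbhd_irrefl[OF vw(1)] extended.has_clique_insert[of v "insert w ?U" "Suc k"]
      extended.has_clique_insert[of w "?U \<inter> ?N v" k] cliques[of "insert w ?U"]
      cliques[of "?U \<inter> ?N v"] cliques[of "?N v \<inter> ?N w"]
    by auto
  then show ?thesis using finite_vertices by (simp add: contains_complete_iff_has_clique)
qed

lemma saturated_graph_neighbourhood_iff:
  assumes simple: "simple_graph V E" and "2 \<le> r"
  shows "saturated_graph V (neighbourhood V E) r \<longleftrightarrow> complete_saturated r V E"
proof -
  obtain k where r: "r = Suc (Suc k)" using assms(2) by (metis add_2_eq_Suc le_Suc_ex)
  interpret neighbourhood_graph V "neighbourhood V E"
    by (rule neighbourhood_graph_neighbourhood) fact
  have "w \<in> neighbourhood V E v \<longleftrightarrow> {v, w} \<in> E" if "w \<in> V" for v w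
    using that by (simp add: neighbourhood_def)
  then show ?thesis
    using neighbourhood_graph_axioms contains_complete_insert_edge_iff[OF simple, of k]
    unfolding saturated_graph_def saturated_graph_axioms_def complete_saturated_def r
      contains_complete_iff_has_clique[OF finite_vertices, of _ E]
    by auto
qed

lemma twin_free_iff_inj_on: "twin_free V E \<longleftrightarrow> inj_on (neighbourhood V E) V"
  unfolding twin_free_def twins_def inj_on_def by blast

lemma (in neighbourhood_graph) obtain_edge_set:
  obtains E where "simple_graph V E" "\<And>v. v \<in> V \<Longrightarrow> neighbourhood V E v = N v"
proof
  let ?E = "{{u, v} |u v. u \<in> V \<and> v \<in> N u}"
  show "simple_graph V ?E"
    unfolding simple_graph_def card_2_iff
    using finite_vertices nbhd_subset nbhd_irrefl by blast
  show "neighbourhood V ?E v = N v" if "v \<in> V" for v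
    using that nbhd_subset nbhd_sym by (auto simp: neighbourhood_def doubleton_eq_iff)
qed

section \<open>Impossible orders\<close>

context saturated_graph
begin

lemma obtain_nonedge:
  assumes "r \<le> card V"
  obtains v w where "v \<in> V" "w \<in> V" "v \<noteq> w" "w \<notin> N v"
proof -
  obtain K where "K \<subseteq> V" "card K = r" "finite K"
    using assms by (meson obtain_subset_with_card_n)
  then have "\<not> clique N K" using clique_free unfolding has_clique_def by blast
  then show thesis using that \<open>K \<subseteq> V\<close> unfolding pairwise_def by blast
qed

lemma obtain_private_neighbour:
  assumes "inj_on N V" "r \<le> card V"
  obtains v w x where "v \<in> V" "w \<in> V" "v \<noteq> w" "w \<notin> N v" "x \<in> N v" "x \<notin> N w"
proof -
  obtain v w where vw: "v \<in> V" "w \<in> V" "v \<noteq> w" "w \<notin> N v"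
    using obtain_nonedge[OF assms(2)] .
  then have "N v \<noteq> N w" using assms(1) by (auto dest: inj_onD)
  then consider x where "x \<in> N v" "x \<notin> N w" | x where "x \<in> N w" "x \<notin> N v" by blast
  then show thesis
    using that[of v w] that[of w v] vw nbhd_sym[of w v] by cases blast+
qed

lemma obtain_completing_clique:
  assumes "v \<in> V" "w \<in> V" "v \<noteq> w" "w \<notin> N v"
  obtains K where "K \<subseteq> V - {v, w}" "K \<subseteq> N v \<inter> N w" "card K = r - 2" "clique N K"
proof -
  obtain K where K: "K \<subseteq> N v \<inter> N w" "card K = r - 2" "clique N K"
    using completes_clique[OF assms] unfolding has_clique_def by blast
  moreover have "N v \<inter> N w \<subseteq> V - {v, w}"
    using assms nbhd_subset nbhd_irrefl by blast
  ultimately show thesis using that by blast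
qed

lemma twin_free_card_neq:
  assumes "inj_on N V"
  shows "card V \<noteq> r"
proof
  assume card: "card V = r"
  obtain v w where vw: "v \<in> V" "w \<in> V" "v \<noteq> w" "w \<notin> N v"
    using obtain_nonedge card by blast
  obtain K where K: "K \<subseteq> V - {v, w}" "K \<subseteq> N v \<inter> N w" "card K = r - 2"
    using obtain_completing_clique[OF vw] .
  have "card (V - {v, w}) = r - 2" using vw card finite_vertices by (simp add: card_Diff_subset)
  then have "K = V - {v, w}" using K finite_vertices by (simp add: card_subset_eq)
  then have "N v = K" "N w = K"
    using K(2) vw nbhd_subset nbhd_irrefl nbhd_sym[of w v] by blast+
  then show False using assms vw by (auto dest: inj_onD)
qed

lemma obtain_completing_clique_omitting_one:
  assumes "card V = Suc r" "v \<in> V" "w \<in> V" "v \<noteq> w" "w \<notin> N v"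
  obtains t where "t \<in> V - {v, w}" "V - {v, w, t} \<subseteq> N v \<inter> N w"
    "clique N (V - {v, w, t})"
proof -
  obtain K where K: "K \<subseteq> V - {v, w}" "K \<subseteq> N v \<inter> N w" "card K = r - 2"
      "clique N K"
    using obtain_completing_clique[OF assms(2-)] .
  have "card (V - {v, w}) = r - 1" using assms finite_vertices by (simp add: card_Diff_subset)
  then have "card (V - {v, w} - K) = 1"
    using K two_le finite_vertices by (simp add: card_Diff_subset finite_subset)
  then obtain t where "V - {v, w} - K = {t}" by (rule card_1_singletonE)
  then have "t \<in> V - {v, w}" "V - {v, w, t} = K" using K(1) by blast+
  then show thesis using that K by blast
qed

lemma twin_free_card_neq_Suc:
  assumes "inj_on N V"
  shows "card V \<noteq> Suc r"
proof
  assume card: "card V = Suc r"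
  obtain u w x where uw: "u \<in> V" "w \<in> V" "u \<noteq> w" "w \<notin> N u" and x: "x \<in> N u" "x \<notin> N w"
    using obtain_private_neighbour[OF assms] card by auto
  obtain t where t: "t \<in> V - {u, w}" "V - {u, w, t} \<subseteq> N u \<inter> N w"
      "clique N (V - {u, w, t})"
    using obtain_completing_clique_omitting_one[OF card uw] .
  have "x \<in> V" "x \<noteq> u" using x(1) uw(1) nbhd_subset nbhd_irrefl by auto
  then have "x = t" using t(2) x uw(4) by blast
  then have wt: "t \<in> V" "w \<noteq> t" "t \<notin> N w" using t(1) x(2) by auto
  obtain s where s: "s \<in> V - {w, t}" "V - {w, t, s} \<subseteq> N w \<inter> N t"
    using obtain_completing_clique_omitting_one[OF card uw(2) wt] .
  have "u \<notin> N w" using uw(2,4) nbhd_sym by blast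
  then have "s = u" using s(2) t(1) uw(1,3) by blast
  then have "V - {u, w, t} \<subseteq> N t" using s(2) by blast
  then have "clique N (insert t (V - {u, w, t}))"
    using t(1,3) by (intro clique_insert[of t]) auto
  then have "clique N (insert u (insert t (V - {u, w, t})))"
    using t(2) x(1) \<open>x = t\<close> uw(1) by (intro clique_insert[of u]) auto
  moreover have "insert u (insert t (V - {u, w, t})) = V - {w}" using uw t(1) by blast
  moreover have "finite (V - {w})" "card (V - {w}) = r" using card uw(2) finite_vertices by auto
  ultimately have "has_clique N r V" unfolding has_clique_def by (intro exI[of _ "V - {w}"]) auto
  then show False using clique_free by blast
qed

end

definition pentagon :: "('a \<Rightarrow> 'a set) \<Rightarrow> 'a \<Rightarrow> 'a \<Rightarrow> 'a \<Rightarrow> 'a \<Rightarrow> 'a \<Rightarrow> bool" where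
  "pentagon N a b c d e \<longleftrightarrow> distinct [a, b, c, d, e] \<and>
    b \<in> N a \<and> c \<in> N b \<and> d \<in> N c \<and> e \<in> N d \<and> a \<in> N e"

lemma pentagon_rotate: "pentagon N a b c d e \<Longrightarrow> pentagon N b c d e a"
  unfolding pentagon_def by auto

locale triangle_saturated_graph = saturated_graph V N 3 for V :: "'a set" and N
begin

lemma triangle_free: "u \<in> V \<Longrightarrow> v \<in> N u \<Longrightarrow> N u \<inter> N v = {}"
  using saturated_graph_axioms unfolding saturated_graph_3_iff by blast

lemma common_neighbour: "u \<in> V \<Longrightarrow> v \<in> V \<Longrightarrow> u \<noteq> v \<Longrightarrow> v \<notin> N u \<Longrightarrow> N u \<inter> N v \<noteq> {}"
  using saturated_graph_axioms unfolding saturated_graph_3_iff by blast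

lemma nbhd_subset_imp_eq:
  assumes "u \<in> V" "v \<in> V" "N u \<subseteq> N v"
  shows "N u = N v"
proof (rule ccontr)
  assume "N u \<noteq> N v"
  then obtain w where w: "w \<in> N v" "w \<notin> N u" using assms(3) by blast
  have "u \<noteq> w" using w(1) assms nbhd_sym nbhd_irrefl by blast
  then have "N u \<inter> N w \<noteq> {}" using common_neighbour w nbhd_subset assms by blast
  then show False using triangle_free[OF assms(2) w(1)] assms(3) by blast
qed

lemma obtain_pentagon:
  assumes "inj_on N V" "3 \<le> card V"
  obtains a b c d e where "{a, b, c, d, e} \<subseteq> V" "pentagon N a b c d e"
proof -
  obtain u w p where uw: "u \<in> V" "w \<in> V" "u \<noteq> w" "w \<notin> N u" and p: "p \<in> N u" "p \<notin> N w"
    using obtain_private_neighbour[OF assms] .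
  obtain s where s: "s \<in> N u" "s \<in> N w" using common_neighbour[OF uw] by blast
  have pV: "p \<in> V" "w \<noteq> p" using p uw nbhd_subset by auto
  then obtain q where q: "q \<in> N w" "q \<in> N p" using common_neighbour[of w p] uw(2) p(2) by blast
  have V: "q \<in> V" "s \<in> V" using q(1) s(1) uw nbhd_subset by auto
  have "q \<noteq> s" using triangle_free[OF uw(1) p(1)] q(2) s(1) by blast
  then have "distinct [u, p, q, w, s]"
    using uw p q s pV V nbhd_irrefl nbhd_sym by auto
  then have "pentagon N u p q w s"
    using p q s uw nbhd_sym unfolding pentagon_def by blast
  then show thesis using that pV V uw by blast
qed

lemma pentagon_nbhd:
  assumes "pentagon N a b c d e" "{a, b, c, d, e} \<subseteq> V"
  shows "N a \<inter> {a, b, c, d, e} = {b, e}"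
proof -
  have "b \<in> N a" "c \<in> N b" "d \<in> N e" "e \<in> N a"
    using assms nbhd_sym unfolding pentagon_def by blast+
  then show ?thesis
    using triangle_free[of a b] triangle_free[of a e] nbhd_irrefl[of a] assms(2) by blast
qed

lemma neighbour_on_pentagon:
  assumes pentagon: "pentagon N a b c d e" and V: "V = {a, b, c, d, e, x, y}"
    and x: "x \<notin> {a, b, c, d, e}"
  shows "N x \<inter> {b, c, d, e} \<noteq> {}"
proof
  assume none: "N x \<inter> {b, c, d, e} = {}"
  have "x \<in> V" using V by simp
  then have Nx: "N x \<subseteq> {a, y}" using nbhd_subset nbhd_irrefl none V by blast
  have mem: "c \<in> V" "d \<in> V" and edge: "d \<in> N c" and a: "a \<notin> {b, c, d, e}"
    using pentagon V by (auto simp: pentagon_def)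
  note pentagon_c = pentagon[THEN pentagon_rotate, THEN pentagon_rotate]
  have "a \<notin> N c" "a \<notin> N d"
    using pentagon_nbhd[OF pentagon_c] pentagon_nbhd[OF pentagon_rotate[OF pentagon_c]] a V by auto
  moreover have "N x \<inter> N c \<noteq> {}" "N x \<inter> N d \<noteq> {}"
    using common_neighbour[OF \<open>x \<in> V\<close>] mem x none by auto
  ultimately have "y \<in> N c" "y \<in> N d" using Nx by auto
  then show False using triangle_free[OF mem(1) edge] by blast
qed

lemma obtain_pentagon_with_two_neighbours:
  assumes pentagon: "pentagon N a b c d e" and V: "V = {a, b, c, d, e, x, y}"
    and x: "x \<notin> {a, b, c, d, e}"
  obtains a' b' c' d' e' where "pentagon N a' b' c' d' e'" "{a', b', c', d', e'} = {a, b, c, d, e}"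
    "b' \<in> N x" "e' \<in> N x"
proof -
  note rotate = pentagon_rotate[of N]
  note pentagons = pentagon pentagon[THEN rotate] pentagon[THEN rotate, THEN rotate]
    pentagon[THEN rotate, THEN rotate, THEN rotate]
    pentagon[THEN rotate, THEN rotate, THEN rotate, THEN rotate]
  have "N x \<inter> {b, c, d, e} \<noteq> {}" "N x \<inter> {c, d, e, a} \<noteq> {}" "N x \<inter> {d, e, a, b} \<noteq> {}"
      "N x \<inter> {e, a, b, c} \<noteq> {}" "N x \<inter> {a, b, c, d} \<noteq> {}"
    using pentagons[THEN neighbour_on_pentagon, of x y] V x by (simp_all add: insert_commute)
  moreover have "\<not> (u \<in> N x \<and> v \<in> N x)" if "v \<in> N u" for u v
    using triangle_free[of x u] that V by auto
  ultimately have "b \<in> N x \<and> e \<in> N x \<or> c \<in> N x \<and> a \<in> N x \<or> d \<in> N x \<and> b \<in> N x \<or>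
      e \<in> N x \<and> c \<in> N x \<or> a \<in> N x \<and> d \<in> N x"
    using pentagon unfolding pentagon_def by auto
  then show thesis using pentagons[THEN that] by (auto simp: insert_commute)
qed

lemma twin_free_mem_pentagon:
  assumes twin_free: "inj_on N V" and "pentagon N a b c d e" and "V = {a, b, c, d, e, x, y}"
  shows "x \<in> {a, b, c, d, e}"
proof (rule ccontr)
  assume notin: "x \<notin> {a, b, c, d, e}"
  obtain a' b' c' d' e' where pentagon: "pentagon N a' b' c' d' e'"
      and rotated: "{a', b', c', d', e'} = {a, b, c, d, e}" and x: "b' \<in> N x" "e' \<in> N x"
    using obtain_pentagon_with_two_neighbours[OF assms(2,3) notin] .
  let ?C = "{a', b', c', d', e'}"
  have V: "V = ?C \<union> {x, y}" using assms(3) rotated by auto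
  have "a' \<in> N b'" "c' \<in> N b'" "d' \<in> N e'" "a' \<in> N e'"
    using pentagon V nbhd_sym[of a' b'] nbhd_sym[of d' e'] unfolding pentagon_def by auto
  moreover have "N x \<inter> N b' = {}" "N x \<inter> N e' = {}" using triangle_free x V by auto
  ultimately have not_adjacent: "N x \<inter> {a', c', d'} = {}" by blast
  then have "N x \<inter> ?C = N a' \<inter> ?C" using x pentagon_nbhd[OF pentagon] V by auto
  moreover have "x \<notin> N x" "x \<notin> N a'"
    using nbhd_irrefl[of x] nbhd_sym[of a' x] not_adjacent V by auto
  moreover have "N x \<subseteq> ?C \<union> {x, y}" "N a' \<subseteq> ?C \<union> {x, y}" using nbhd_subset V by blast+
  ultimately have "N x \<subseteq> N a' \<or> N a' \<subseteq> N x" by blast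
  then have "N x = N a'" using nbhd_subset_imp_eq V by blast
  then show False using inj_onD[OF twin_free, of x a'] V notin rotated by blast
qed

lemma twin_free_card_notin:
  assumes "inj_on N V"
  shows "card V \<notin> {6, 7}"
proof
  assume card: "card V \<in> {6, 7}"
  then have "3 \<le> card V" by auto
  then obtain a b c d e where sub: "{a, b, c, d, e} \<subseteq> V" and pentagon: "pentagon N a b c d e"
    using obtain_pentagon[OF assms] by blast
  have "card {a, b, c, d, e} = 5" using pentagon unfolding pentagon_def by simp
  then have "card (V - {a, b, c, d, e}) = 1 \<or> card (V - {a, b, c, d, e}) = 2"
    using card sub finite_vertices by (auto simp: card_Diff_subset)
  then obtain x y where "V - {a, b, c, d, e} = {x, y}"
    by (metis card_1_singletonE card_2_iff insert_absorb2)
  then have "V = {a, b, c, d, e, x, y}" "x \<notin> {a, b, c, d, e}" using sub by blast+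
  then show False using twin_free_mem_pentagon[OF assms pentagon] by blast
qed

end

section \<open>Constructions\<close>

definition attach :: "'a \<Rightarrow> 'a set \<Rightarrow> ('a \<Rightarrow> 'a set) \<Rightarrow> 'a \<Rightarrow> 'a set" where
  "attach x S N v = (if v = x then S else if v \<in> S then insert x (N v) else N v)"

lemma attach_new [simp]: "attach x S N x = S"
  by (simp add: attach_def)

lemma attach_mem: "v \<in> S \<Longrightarrow> v \<noteq> x \<Longrightarrow> attach x S N v = insert x (N v)"
  by (simp add: attach_def)

lemma attach_not_mem: "v \<notin> S \<Longrightarrow> v \<noteq> x \<Longrightarrow> attach x S N v = N v"
  by (simp add: attach_def)

lemma has_clique_attach: "x \<notin> T \<Longrightarrow> has_clique (attach x S N) k T \<longleftrightarrow> has_clique N k T"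
  by (intro has_clique_cong) (auto simp: attach_def)

context neighbourhood_graph
begin

lemma neighbourhood_graph_attach:
  assumes "x \<notin> V" "S \<subseteq> V"
  shows "neighbourhood_graph (insert x V) (attach x S N)"
proof
  have "x \<notin> N v" if "v \<in> V" for v using that assms(1) nbhd_subset by blast
  fix v w assume v: "v \<in> insert x V"
  show "attach x S N v \<subseteq> insert x V" "v \<notin> attach x S N v"
    using v assms nbhd_subset nbhd_irrefl by (auto simp: attach_def)
  show "v \<in> attach x S N w" if "w \<in> attach x S N v"
    using that v assms nbhd_sym \<open>\<And>v. v \<in> V \<Longrightarrow> x \<notin> N v\<close>
    by (auto simp: attach_def split: if_splits)
qed (simp add: finite_vertices)

lemma has_clique_attach_insert:
  assumes "x \<notin> V" "S \<subseteq> V" "T \<subseteq> V"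
  shows "has_clique (attach x S N) (Suc k) (insert x T) \<longleftrightarrow>
    has_clique N (Suc k) T \<or> has_clique N k (T \<inter> S)"
proof -
  interpret attached: neighbourhood_graph "insert x V" "attach x S N"
    using assms(1,2) by (rule neighbourhood_graph_attach)
  have "attach x S N x = S" "x \<notin> T" "x \<notin> T \<inter> S" using assms by (auto simp: attach_def)
  then show ?thesis
    using assms(3) attached.has_clique_insert[of x T k]
    by (simp add: has_clique_attach subset_insertI2)
qed

lemma inj_on_attach:
  assumes "inj_on N V" "x \<notin> V" "S \<subseteq> V" "S \<notin> N ` V"
  shows "inj_on (attach x S N) (insert x V)"
proof -
  have remove: "attach x S N v - {x} = N v" if "v \<in> V" for v
    using that assms(2) nbhd_subset by (auto simp: attach_def)
  then have "inj_on (attach x S N) V" using assms(1) unfolding inj_on_def by metis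
  moreover have "attach x S N x \<noteq> attach x S N v" if "v \<in> V" for v
  proof -
    have "attach x S N x - {x} = S" using assms(2,3) by auto
    then show ?thesis using remove[OF that] that assms(4) by auto
  qed
  ultimately show ?thesis by auto
qed

end

context saturated_graph
begin

lemma completes_clique_attach:
  assumes x: "x \<notin> V" and outside: "\<And>v. v \<in> V - S \<Longrightarrow> has_clique N (r - 2) (S \<inter> N v)"
    and v: "v \<in> V" and w: "w \<in> insert x V" "v \<noteq> w" "w \<notin> attach x S N v"
  shows "has_clique (attach x S N) (r - 2) (attach x S N v \<inter> attach x S N w)"
proof -
  have x_v: "x \<notin> N v" "v \<noteq> x" using v x nbhd_subset by auto
  show ?thesis
  proof (cases "w = x")
    case True
    then have "v \<notin> S" using w(3) x_v by (auto simp: attach_mem)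
    then have "attach x S N v \<inter> attach x S N w = S \<inter> N v"
      using True x_v by (auto simp: attach_not_mem)
    then show ?thesis using outside v \<open>v \<notin> S\<close> x_v by (simp add: has_clique_attach)
  next
    case False
    then have "w \<in> V" "w \<notin> N v" using w x_v by (auto simp: attach_def split: if_splits)
    then have "has_clique (attach x S N) (r - 2) (N v \<inter> N w)"
      using completes_clique v w(2) x_v by (simp add: has_clique_attach)
    then show ?thesis by (rule has_clique_mono) (use False x_v in \<open>auto simp: attach_def\<close>)
  qed
qed

lemma saturated_attach:
  assumes x: "x \<notin> V" and S: "S \<subseteq> V" "\<not> has_clique N (r - 1) S"
    and outside: "\<And>v. v \<in> V - S \<Longrightarrow> has_clique N (r - 2) (S \<inter> N v)"
  shows "saturated_graph (insert x V) (attach x S N) r"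
proof -
  let ?N = "attach x S N"
  interpret attached: neighbourhood_graph "insert x V" ?N
    using x S(1) by (rule neighbourhood_graph_attach)
  note completes = completes_clique_attach[OF x outside]
  show ?thesis
  proof
    have "V \<inter> S = S" "Suc (r - 1) = r" using S(1) two_le by auto
    then show "\<not> has_clique ?N r (insert x V)"
      using has_clique_attach_insert[OF x S(1) order_refl, of "r - 1"] S(2) clique_free by simp
    fix v w assume vw: "v \<in> insert x V" "w \<in> insert x V" "v \<noteq> w" "w \<notin> ?N v"
    show "has_clique ?N (r - 2) (?N v \<inter> ?N w)"
    proof (cases "v \<in> V")
      case True
      then show ?thesis using completes vw by blast
    next
      case False
      then have "w \<in> V" "v \<notin> ?N w" using vw attached.nbhd_sym[of w v] by auto
      then show ?thesis using completes[of w v] vw by (simp add: Int_commute)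
    qed
  qed (fact two_le)
qed

lemma saturated_dominate:
  assumes x: "x \<notin> V"
  shows "saturated_graph (insert x V) (attach x V N) (Suc r)"
proof -
  let ?N = "attach x V N"
  interpret attached: neighbourhood_graph "insert x V" ?N
    using x by (rule neighbourhood_graph_attach) simp
  have "\<not> has_clique N (Suc r) V"
    using clique_free has_clique_Suc[of V r] has_clique_mono[of N r _ V] by blast
  show ?thesis
  proof
    show "\<not> has_clique ?N (Suc r) (insert x V)"
      using has_clique_attach_insert[OF x order_refl order_refl, of r] clique_free
        \<open>\<not> has_clique N (Suc r) V\<close> by simp
  next
    fix v w assume "v \<in> insert x V" "w \<in> insert x V" "v \<noteq> w" "w \<notin> ?N v"
    then have vw: "v \<in> V" "w \<in> V" "v \<noteq> w" "w \<notin> N v"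
      by (auto simp: attach_def split: if_splits)
    have "N v \<inter> N w \<subseteq> V" using nbhd_subset vw(1) by blast
    then have "has_clique ?N (Suc (r - 2)) (insert x (N v \<inter> N w))"
      using has_clique_attach_insert[OF x order_refl, of "N v \<inter> N w" "r - 2"]
        completes_clique[OF vw]
      by (simp add: inf.absorb1)
    moreover have "?N v \<inter> ?N w = insert x (N v \<inter> N w)" using vw x by (auto simp: attach_def)
    moreover have "Suc (r - 2) = Suc r - 2" using two_le by simp
    ultimately show "has_clique ?N (Suc r - 2) (?N v \<inter> ?N w)" by metis
  qed (use two_le in simp)
qed

end

text \<open>
  \<open>Q\<close> need not dominate \<open>P\<close>, nor \<open>R\<close> dominate \<open>Q\<close>: once a new vertex \<open>x\<close> is joined to \<open>P\<close>, the set
  \<open>Q \<union> {x}\<close> dominates \<open>P\<close>, and the three sets have moved on cyclically to \<open>Q \<union> {x}\<close>, \<open>R\<close>, \<open>P\<close>.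
\<close>

locale attachable_triple = neighbourhood_graph V N for V :: "'a set" and N +
  fixes P Q R :: "'a set"
  assumes subsets: "P \<subseteq> V" "Q \<subseteq> V" "R \<subseteq> V"
    and disjoint: "P \<inter> Q = {}" "P \<inter> R = {}" "Q \<inter> R = {}"
    and nonempty: "P \<noteq> {}" "R \<noteq> {}"
    and independent: "\<forall>u\<in>P. P \<inter> N u = {}" "\<forall>u\<in>Q. Q \<inter> N u = {}" "\<forall>u\<in>R. R \<inter> N u = {}"
    and dominating: "\<forall>u\<in>V - P. P \<inter> N u \<noteq> {}" "\<forall>u\<in>V - (P \<union> Q). Q \<inter> N u \<noteq> {}"
      "\<forall>u\<in>V - (Q \<union> R). R \<inter> N u \<noteq> {}"
    and not_nbhd: "P \<notin> N ` V" "Q \<notin> N ` P" "R \<notin> N ` Q"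

context attachable_triple
begin

lemma saturated_attach_triple:
  assumes "saturated_graph V N 3" "x \<notin> V"
  shows "saturated_graph (insert x V) (attach x P N) 3"
proof -
  interpret saturated_graph V N 3 by fact
  show ?thesis
  proof (rule saturated_attach[OF assms(2) subsets(1)])
    show "\<not> has_clique N (3 - 1) P" using has_clique_2[OF subsets(1)] independent(1) by simp
    fix v assume "v \<in> V - P"
    moreover have "P \<inter> N v \<subseteq> V" using subsets(1) by blast
    ultimately have "has_clique N 1 (P \<inter> N v)"
      using has_clique_1[of "P \<inter> N v"] dominating(1) by blast
    then show "has_clique N (3 - 2) (P \<inter> N v)" by simp
  qed
qed

lemma attach_eq_nbhd:
  assumes "x \<notin> V" "u \<in> Q \<union> R"
  shows "attach x P N u = N u"
  using assms subsets disjoint by (intro attach_not_mem) auto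

lemma not_nbhd_attach:
  assumes x: "x \<notin> V"
  shows "insert x Q \<notin> attach x P N ` insert x V" "R \<notin> attach x P N ` insert x Q"
    "P \<notin> attach x P N ` R"
proof -
  let ?N = "attach x P N"
  have x_notin: "x \<notin> P" "x \<notin> Q" using x subsets by auto
  have "insert x Q \<noteq> ?N u" if u: "u \<in> V" for u
  proof (cases "u \<in> P")
    case True
    then have "Q \<noteq> N u" "x \<notin> N u" "u \<noteq> x" using not_nbhd(2) u x nbhd_subset by auto
    then show ?thesis using attach_mem[OF True] x_notin by (simp add: insert_ident)
  next
    case False
    then have "x \<notin> ?N u" using u x nbhd_subset by (auto simp: attach_def)
    then show ?thesis by blast
  qed
  then show "insert x Q \<notin> ?N ` insert x V" using x_notin by auto
  have "R \<noteq> ?N u" if "u \<in> Q" for u using that not_nbhd(3) attach_eq_nbhd[OF x] by auto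
  moreover have "R \<noteq> P" using disjoint nonempty by auto
  ultimately show "R \<notin> ?N ` insert x Q" by auto
  show "P \<notin> ?N ` R" using not_nbhd(1) attach_eq_nbhd[OF x] subsets(3) by auto
qed

lemma attachable_triple_attach:
  assumes x: "x \<notin> V"
  shows "attachable_triple (insert x V) (attach x P N) (insert x Q) R P"
proof -
  let ?N = "attach x P N"
  interpret attached: neighbourhood_graph "insert x V" ?N
    using x subsets(1) by (rule neighbourhood_graph_attach)
  have x_notin: "x \<notin> P" "x \<notin> Q" "x \<notin> R" using x subsets by auto
  have x_notin_nbhd: "x \<notin> N u" if "u \<in> Q" for u
    using that x subsets(2) nbhd_subset[of u] by blast
  have N_P: "?N u = insert x (N u)" if "u \<in> P" for u
    using that x_notin(1) by (intro attach_mem) auto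
  have N_V: "?N u = N u" if "u \<in> V - P" for u using that x by (intro attach_not_mem) auto
  note N_QR = attach_eq_nbhd[OF x]
  show ?thesis
  proof
    show "insert x Q \<subseteq> insert x V" "R \<subseteq> insert x V" "P \<subseteq> insert x V" using subsets by auto
    show "insert x Q \<inter> R = {}" "insert x Q \<inter> P = {}" "R \<inter> P = {}" using disjoint x_notin by auto
    show "insert x Q \<noteq> {}" "P \<noteq> {}" using nonempty by auto
    show "\<forall>u\<in>insert x Q. insert x Q \<inter> ?N u = {}"
      using N_QR x_notin x_notin_nbhd disjoint independent(2) by auto
    show "\<forall>u\<in>R. R \<inter> ?N u = {}" using N_QR independent(3) by simp
    show "\<forall>u\<in>P. P \<inter> ?N u = {}" using N_P x_notin(1) independent(1) by simp
    have "insert x Q \<inter> ?N u \<noteq> {}" if "u \<in> V - Q" for u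
      using that N_P[of u] N_V[of u] dominating(2) by (cases "u \<in> P") auto
    then show "\<forall>u\<in>insert x V - insert x Q. insert x Q \<inter> ?N u \<noteq> {}" by blast
    have "R \<inter> ?N u \<noteq> {}" if "u \<in> V - (Q \<union> R)" for u
      using that N_P[of u] N_V[of u] dominating(3) by (cases "u \<in> P") auto
    then show "\<forall>u\<in>insert x V - (insert x Q \<union> R). R \<inter> ?N u \<noteq> {}" by blast
    show "\<forall>u\<in>insert x V - (R \<union> P). P \<inter> ?N u \<noteq> {}"
      using N_V nonempty(1) dominating(1) by auto
  qed (fact not_nbhd_attach[OF x])+
qed

end

definition realizable :: "nat \<Rightarrow> nat \<Rightarrow> bool" where
  "realizable r n \<longleftrightarrow> (\<exists>N. saturated_graph {..<n} N r \<and> inj_on N {..<n})"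

lemma realizableI: "saturated_graph {..<n} N r \<Longrightarrow> inj_on N {..<n} \<Longrightarrow> realizable r n"
  unfolding realizable_def by blast

lemma realizable_less:
  assumes "2 \<le> r" "n < r"
  shows "realizable r n"
proof -
  let ?N = "\<lambda>v. {..<n} - {v}"
  have "saturated_graph {..<n} ?N r"
  proof
    show "\<not> has_clique ?N r {..<n}"
    proof
      assume "has_clique ?N r {..<n}"
      then obtain K where "K \<subseteq> {..<n}" "card K = r" unfolding has_clique_def by blast
      then show False using card_mono[of "{..<n}" K] assms(2) by simp
    qed
  qed (use assms(1) in auto)
  moreover have "inj_on ?N {..<n}" by (rule inj_onI) blast
  ultimately show ?thesis by (rule realizableI)
qed

lemma realizable_Suc:
  assumes "realizable r n"
  shows "realizable (Suc r) (Suc n)"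
proof -
  obtain N where N: "saturated_graph {..<n} N r" "inj_on N {..<n}"
    using assms unfolding realizable_def by blast
  interpret saturated_graph "{..<n}" N r by (rule N(1))
  have "{..<n} \<notin> N ` {..<n}" using nbhd_irrefl by blast
  then show ?thesis
    using saturated_dominate[of n] inj_on_attach[OF N(2), of n "{..<n}"]
    unfolding realizable_def lessThan_Suc by blast
qed

definition five_cycle :: "nat \<Rightarrow> nat set" where
  "five_cycle = (!) [{1, 4}, {0, 2}, {1, 3}, {2, 4}, {0, 3}]"

lemma realizable_3_5: "realizable 3 5"
proof -
  have "saturated_graph {..<5} five_cycle 3"
    unfolding saturated_graph_3_iff neighbourhood_graph_iff
    by (intro conjI finite_lessThan) code_simp+
  moreover have "inj_on five_cycle {..<5}" by code_simp
  ultimately show ?thesis by (rule realizableI)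
qed

definition moebius_ladder_8 :: "nat \<Rightarrow> nat set" where
  "moebius_ladder_8 = (!) [{1, 4, 7}, {0, 2, 5}, {1, 3, 6}, {2, 4, 7}, {0, 3, 5}, {1, 4, 6},
     {2, 5, 7}, {0, 3, 6}]"

lemma realizable_3_8: "realizable 3 8"
proof -
  have "saturated_graph {..<8} moebius_ladder_8 3"
    unfolding saturated_graph_3_iff neighbourhood_graph_iff
    by (intro conjI finite_lessThan) code_simp+
  moreover have "inj_on moebius_ladder_8 {..<8}" by code_simp
  ultimately show ?thesis by (rule realizableI)
qed

text \<open>Found by computer search.\<close>

definition nine_vertex_graph :: "nat \<Rightarrow> nat set" where
  "nine_vertex_graph = (!) [{4, 5, 6}, {4, 6, 8}, {5, 6, 7}, {6, 7, 8}, {0, 1, 7}, {0, 2, 8},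
     {0, 1, 2, 3}, {2, 3, 4}, {1, 3, 5}]"

lemma nine_vertex_graph:
  "saturated_graph {..<9} nine_vertex_graph 3" "inj_on nine_vertex_graph {..<9}"
  "attachable_triple {..<9} nine_vertex_graph {3, 4, 5} {0, 1, 2} {6, 7, 8}"
proof -
  show "saturated_graph {..<9} nine_vertex_graph 3"
    unfolding saturated_graph_3_iff neighbourhood_graph_iff
    by (intro conjI finite_lessThan) code_simp+
  then have "neighbourhood_graph {..<9} nine_vertex_graph" unfolding saturated_graph_3_iff by blast
  then show "attachable_triple {..<9} nine_vertex_graph {3, 4, 5} {0, 1, 2} {6, 7, 8}"
    unfolding attachable_triple_def attachable_triple_axioms_def
    by (intro conjI) (assumption | code_simp)+
  show "inj_on nine_vertex_graph {..<9}" by code_simp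
qed

lemma realizable_3_ge_9:
  assumes "9 \<le> n"
  shows "realizable 3 n"
proof -
  have "\<exists>N P Q R. saturated_graph {..<n} N 3 \<and> inj_on N {..<n} \<and> attachable_triple {..<n} N P Q R"
    using assms
  proof (induction n rule: nat_induct_at_least)
    case base
    show ?case using nine_vertex_graph by blast
  next
    case (Suc n)
    then obtain N P Q R where N: "saturated_graph {..<n} N 3" "inj_on N {..<n}"
        "attachable_triple {..<n} N P Q R"
      by blast
    interpret attachable_triple "{..<n}" N P Q R by (rule N(3))
    have "inj_on (attach n P N) (insert n {..<n})"
      using N(2) subsets(1) not_nbhd(1) by (intro inj_on_attach) auto
    then show ?case
      using saturated_attach_triple[OF N(1), of n] attachable_triple_attach[of n]
      unfolding lessThan_Suc by blast
  qed
  then show ?thesis unfolding realizable_def by blast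
qed

lemma realizable_3:
  assumes "n = 5 \<or> 8 \<le> n"
  shows "realizable 3 n"
proof -
  consider "n = 5" | "n = 8" | "9 \<le> n" using assms by linarith
  then show ?thesis using realizable_3_5 realizable_3_8 realizable_3_ge_9 by cases auto
qed

definition seven_cycle_complement :: "nat \<Rightarrow> nat set" where
  "seven_cycle_complement = (!) [{2, 3, 4, 5}, {3, 4, 5, 6}, {0, 4, 5, 6}, {0, 1, 5, 6},
     {0, 1, 2, 6}, {0, 1, 2, 3}, {1, 2, 3, 4}]"

lemma seven_cycle_complement:
  "saturated_graph {..<7} seven_cycle_complement 4" "inj_on seven_cycle_complement {..<7}"
proof -
  show "saturated_graph {..<7} seven_cycle_complement 4"
    unfolding saturated_graph_4_iff neighbourhood_graph_iff
    by (intro conjI finite_lessThan) code_simp+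
  show "inj_on seven_cycle_complement {..<7}" by code_simp
qed

lemma realizable_4_7: "realizable 4 7"
  using seven_cycle_complement by (rule realizableI)

lemma realizable_4_8: "realizable 4 8"
proof -
  let ?N = seven_cycle_complement and ?S = "{0, 1, 3, 4 :: nat}"
  interpret saturated_graph "{..<7}" ?N 4 by (rule seven_cycle_complement)
  have S: "?S \<subseteq> {..<7}" by simp
  have "saturated_graph (insert 7 {..<7}) (attach 7 ?S ?N) 4"
  proof (rule saturated_attach[OF _ S])
    have "\<not> (\<exists>u\<in>?S. \<exists>v\<in>?S \<inter> ?N u. ?S \<inter> ?N u \<inter> ?N v \<noteq> {})" by code_simp
    then show "\<not> has_clique ?N (4 - 1) ?S" using has_clique_3[OF S] by simp
    fix v assume "v \<in> {..<7} - ?S"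
    moreover have "\<forall>v\<in>{..<7} - ?S. \<exists>u\<in>?S \<inter> ?N v. ?S \<inter> ?N v \<inter> ?N u \<noteq> {}" by code_simp
    ultimately have "\<exists>u\<in>?S \<inter> ?N v. ?S \<inter> ?N v \<inter> ?N u \<noteq> {}" by (rule bspec[rotated])
    moreover have "?S \<inter> ?N v \<subseteq> {..<7}" using S by (rule le_infI1)
    ultimately have "has_clique ?N 2 (?S \<inter> ?N v)" by (simp only: has_clique_2)
    then show "has_clique ?N (4 - 2) (?S \<inter> ?N v)" by simp
  qed simp
  moreover have "?S \<notin> ?N ` {..<7}" by code_simp
  then have "inj_on (attach 7 ?S ?N) (insert 7 {..<7})"
    using seven_cycle_complement(2) S by (intro inj_on_attach) simp_all
  moreover have "insert 7 {..<7} = {..<8::nat}" by auto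
  ultimately show ?thesis unfolding realizable_def by metis
qed

lemma realizable_ge_4:
  assumes "4 \<le> r" "r + 2 \<le> n"
  shows "realizable r n"
  using assms
proof (induction r arbitrary: n rule: nat_induct_at_least)
  case base
  then consider "n = 7" | "n = 8" | m where "n = Suc m" "m = 5 \<or> 8 \<le> m" by (cases n) force+
  then show ?case
  proof cases
    case 3
    then show ?thesis using realizable_Suc[OF realizable_3[OF 3(2)]] by simp
  qed (use realizable_4_7 realizable_4_8 in auto)
next
  case (Suc r)
  then obtain m where "n = Suc m" "r + 2 \<le> m" by (cases n) auto
  then show ?case using realizable_Suc Suc.IH by simp
qed

lemma realizable_obtain_edge_set:
  assumes "realizable r n"
  obtains E where "simple_graph {..<n} E" "twin_free {..<n} E" "complete_saturated r {..<n} E"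
proof -
  obtain N where N: "saturated_graph {..<n} N r" "inj_on N {..<n}"
    using assms unfolding realizable_def by blast
  interpret saturated_graph "{..<n}" N r by (rule N(1))
  obtain E where E: "simple_graph {..<n} E" "\<And>v. v \<in> {..<n} \<Longrightarrow> neighbourhood {..<n} E v = N v"
    using obtain_edge_set by blast
  have "twin_free {..<n} E" using N(2) E(2) inj_on_cong[of "{..<n}" N] twin_free_iff_inj_on by metis
  moreover have "complete_saturated r {..<n} E"
    using saturated_graph_cong[OF N(1) E(2)]
      saturated_graph_neighbourhood_iff[OF E(1) two_le] by simp
  ultimately show thesis using that E(1) by blast
qed

theorem theorem1:
  fixes r n :: nat
  assumes "r \<ge> 3"
  shows "(\<exists>(V :: nat set) E. simple_graph V E \<and> card V = n \<and>
            twin_free V E \<and> complete_saturated r V E) \<longleftrightarrow>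
         \<not> (n = r \<or> n = r + 1 \<or> (r = 3 \<and> n = 6) \<or> (r = 3 \<and> n = 7))"
    (is "?exists \<longleftrightarrow> \<not> ?excluded")
proof
  assume ?exists
  then obtain V :: "nat set" and E where "simple_graph V E" "twin_free V E"
      "complete_saturated r V E" and n: "card V = n"
    by blast
  then have twin_free: "inj_on (neighbourhood V E) V"
    and saturated: "saturated_graph V (neighbourhood V E) r"
    using assms twin_free_iff_inj_on saturated_graph_neighbourhood_iff[of V E r] by auto
  have "card V \<noteq> r" using saturated_graph.twin_free_card_neq[OF saturated twin_free] .
  moreover have "card V \<noteq> Suc r"
    using saturated_graph.twin_free_card_neq_Suc[OF saturated twin_free] .
  moreover have "card V \<notin> {6, 7}" if "r = 3"
    using triangle_saturated_graph.twin_free_card_notin[OF _ twin_free] saturated that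
    unfolding triangle_saturated_graph_def by blast
  ultimately show "\<not> ?excluded" using n by auto
next
  assume "\<not> ?excluded"
  then consider "n < r" | "r = 3" "n = 5 \<or> 8 \<le> n" | "4 \<le> r" "r + 2 \<le> n"
    using assms by linarith
  then have "realizable r n" using assms realizable_less realizable_3 realizable_ge_4 by cases auto
  then show ?exists using realizable_obtain_edge_set[of r n] card_lessThan by blast
qed

end
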